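(* Let $\Sigma$ be a set of tgds and let $\widetilde{\Sigma}$ be its semi-enrichment. Then $\Sigma\in\mathsf{CT}^{\mathsf{sobl}}_{\forall\forall}$ if and only if $\widetilde{\Sigma}\in\mathsf{CT}^{\mathsf{std}}_{\forall\forall}$.
   Context: Let $\mathsf{Cons}$ (constants), $\mathsf{Nulls}$ (nulls) and $\mathsf{Vars}$ (variables) be pairwise disjoint countably infinite sets. A schema is a finite set of relation symbols with arities. An instance is a finite set of atoms $R(a_1,\dots,a_k)$ with $a_i\in\mathsf{Cons}\cup\mathsf{Nulls}$. A tgd $\xi=\alpha\to\beta$ is a sentence $\forall\bar x,\bar y\,(\alpha(\bar x,\bar y)\to\exists\bar z\,\beta(\bar x,\bar z))$, with body $\alpha$ and head $\beta$ conjunctions of relational atoms over variables and constants; $\bar x$ are the universal variables occurring in both body and head, $\bar y$ those occurring only in the body. Sets of tgds are finite. A trigger for $\Sigma$ on $I$ is a pair $(\xi,h)$ with $\xi=\alpha\to\beta\in\Sigma$ and $h$ a mapping of the universal variables of $\xi$ to $\mathsf{Cons}\cup\mathsf{Nulls}$ (identity on constants) with $h(\alpha)\subseteq I$. It is active on $I$ if no extension $h'$ of $h$ satisfies $h'(\beta)\subseteq I$. Firing it transforms $I$ into $J=I\cup h'(\beta)$, where $h'$ extends $h$ by assigning new fresh nulls to the existential variables. A chase sequence from $I_0=I$ with $\Sigma$ is a finite or infinite sequence $I_0,I_1,\dots$ in which each $I_{i+1}$ is obtained from $I_i$ by firing an applicable trigger. It terminates if some $I_i$ has no applicable trigger left.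 In the standard chase ($\mathsf{std}$) the applicable triggers are those active on the current instance. In the semi-oblivious chase ($\mathsf{sobl}$), triggers $(\xi,h)$ and $(\xi,g)$ are equivalent if $h(\bar x)=g(\bar x)$; the applicable triggers are all triggers (active or not) on the current instance whose equivalence class contains no trigger already fired in the sequence, so that exactly one trigger from each class is fired. All chase sequences are assumed fair: in an infinite sequence, a trigger applicable at some step is, at some later step, fired or no longer applicable. For $\star\in\{\mathsf{std},\mathsf{sobl}\}$, $\mathsf{CT}^\star_{\forall\forall}$ is the class of all sets $\Sigma$ of tgds such that for every instance $I$ all $\star$-chase sequences with $\Sigma$ on $I$ terminate. Semi-enrichment: for a tgd $\xi=\alpha(\bar x,\bar y)\to\exists\bar z\,\beta(\bar x,\bar z)$ over a schema $\mathbf R$, let $\tilde\xi=\alpha(\bar x,\bar y)\to\exists\bar z\,\beta(\bar x,\bar z),H(\bar x)$, where $H$ is a new relation symbol not in $\mathbf R$ (a separate one for each tgd). For a set $\Sigma$ of tgds, $\widetilde\Sigma=\{\tilde\xi:\xi\in\Sigma\}$. *)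

theory Defs
  imports Main "HOL-Library.Extended_Nat"
begin

text \<open>Constants, nulls and variables are three disjoint copies of the natural numbers.
  Values are what occurs in instances, terms are what occurs in dependencies.\<close>

datatype val = Const nat | Null nat

datatype tm = Var nat | Cst nat

datatype ('r, 't) atom = Atom (rel: 'r) (args: "'t list")

text \<open>A conjunction is a list of atoms. The quantifiers of a tgd are implicit: the universal
  variables are those of the body, the existential ones are those occurring only in the head.\<close>

datatype 'r tgd = Tgd (body: "('r, tm) atom list") (head: "('r, tm) atom list")

type_synonym 'r schema = "'r \<rightharpoonup> nat"
type_synonym 'r inst = "('r, val) atom set"
type_synonym 'r trigger = "'r tgd \<times> (nat \<rightharpoonup> val)"

definition is_schema :: "'r schema \<Rightarrow> bool" where
  "is_schema S \<longleftrightarrow> finite (dom S)"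

definition atom_over :: "'r schema \<Rightarrow> ('r, 't) atom \<Rightarrow> bool" where
  "atom_over S a \<longleftrightarrow> S (rel a) = Some (length (args a))"

definition is_inst :: "'r schema \<Rightarrow> 'r inst \<Rightarrow> bool" where
  "is_inst S I \<longleftrightarrow> finite I \<and> (\<forall>a\<in>I. atom_over S a)"

definition tgd_over :: "'r schema \<Rightarrow> 'r tgd \<Rightarrow> bool" where
  "tgd_over S \<xi> \<longleftrightarrow> (\<forall>a \<in> set (body \<xi>) \<union> set (head \<xi>). atom_over S a)"

definition is_tgd_set :: "'r schema \<Rightarrow> 'r tgd set \<Rightarrow> bool" where
  "is_tgd_set S \<Sigma> \<longleftrightarrow> finite \<Sigma> \<and> (\<forall>\<xi>\<in>\<Sigma>. tgd_over S \<xi>)"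

fun tm_vars :: "tm \<Rightarrow> nat list" where
  "tm_vars (Var v) = [v]"
| "tm_vars (Cst c) = []"

definition conj_vars :: "('r, tm) atom list \<Rightarrow> nat list" where
  "conj_vars as = concat (map (\<lambda>a. concat (map tm_vars (args a))) as)"

definition univ_vars :: "'r tgd \<Rightarrow> nat set" where
  "univ_vars \<xi> = set (conj_vars (body \<xi>))"

definition exist_vars :: "'r tgd \<Rightarrow> nat set" where
  "exist_vars \<xi> = set (conj_vars (head \<xi>)) - set (conj_vars (body \<xi>))"

text \<open>The tuple of universal variables shared by body and head, without repetitions.\<close>

definition frontier :: "'r tgd \<Rightarrow> nat list" where
  "frontier \<xi> = remdups (filter (\<lambda>v. v \<in> set (conj_vars (head \<xi>))) (conj_vars (body \<xi>)))"

text \<open>Only applied to terms whose variables lie in the domain of the assignment.\<close>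

fun app_tm :: "(nat \<rightharpoonup> val) \<Rightarrow> tm \<Rightarrow> val" where
  "app_tm h (Var v) = the (h v)"
| "app_tm h (Cst c) = Const c"

definition app_conj :: "(nat \<rightharpoonup> val) \<Rightarrow> ('r, tm) atom list \<Rightarrow> 'r inst" where
  "app_conj h as = (\<lambda>a. Atom (rel a) (map (app_tm h) (args a))) ` set as"

definition inst_vals :: "'r inst \<Rightarrow> val set" where
  "inst_vals I = (\<Union>a\<in>I. set (args a))"

definition is_trigger :: "'r tgd set \<Rightarrow> 'r inst \<Rightarrow> 'r trigger \<Rightarrow> bool" where
  "is_trigger \<Sigma> I t \<longleftrightarrow> (case t of (\<xi>, h) \<Rightarrow>
     \<xi> \<in> \<Sigma> \<and> dom h = univ_vars \<xi> \<and> app_conj h (body \<xi>) \<subseteq> I)"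

definition is_extension :: "'r trigger \<Rightarrow> (nat \<rightharpoonup> val) \<Rightarrow> bool" where
  "is_extension t h' \<longleftrightarrow> (case t of (\<xi>, h) \<Rightarrow>
     dom h' = univ_vars \<xi> \<union> exist_vars \<xi> \<and> h \<subseteq>\<^sub>m h')"

definition active :: "'r inst \<Rightarrow> 'r trigger \<Rightarrow> bool" where
  "active I t \<longleftrightarrow> \<not> (\<exists>h'. is_extension t h' \<and> app_conj h' (head (fst t)) \<subseteq> I)"

definition fires :: "'r inst \<Rightarrow> 'r trigger \<Rightarrow> 'r inst \<Rightarrow> bool" where
  "fires I t J \<longleftrightarrow> (\<exists>h'. is_extension t h'
     \<and> inj_on h' (exist_vars (fst t))
     \<and> (\<forall>z \<in> exist_vars (fst t). \<exists>n. h' z = Some (Null n) \<and> Null n \<notin> inst_vals I)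
     \<and> J = I \<union> app_conj h' (head (fst t)))"

definition trigger_equiv :: "'r trigger \<Rightarrow> 'r trigger \<Rightarrow> bool" where
  "trigger_equiv s t \<longleftrightarrow> fst s = fst t \<and>
     map (snd s) (frontier (fst s)) = map (snd t) (frontier (fst t))"

datatype chase_kind = Std | Sobl

text \<open>The set \<open>F\<close> consists of the triggers fired so far.\<close>

fun applicable :: "chase_kind \<Rightarrow> 'r tgd set \<Rightarrow> 'r trigger set \<Rightarrow> 'r inst \<Rightarrow> 'r trigger \<Rightarrow> bool" where
  "applicable Std \<Sigma> F I t \<longleftrightarrow> is_trigger \<Sigma> I t \<and> active I t"
| "applicable Sobl \<Sigma> F I t \<longleftrightarrow> is_trigger \<Sigma> I t \<and> \<not> (\<exists>s\<in>F. trigger_equiv s t)"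

text \<open>A finite or infinite sequence of \<open>N\<close> steps is given by the instances \<open>Is i\<close> for \<open>i \<le> N\<close>
  and the triggers \<open>ts i\<close> for \<open>i < N\<close>, where \<open>ts i\<close> is fired on \<open>Is i\<close>.
  Values at other indices are irrelevant.\<close>

definition applicable_at ::
  "chase_kind \<Rightarrow> 'r tgd set \<Rightarrow> (nat \<Rightarrow> 'r inst) \<Rightarrow> (nat \<Rightarrow> 'r trigger) \<Rightarrow> nat \<Rightarrow> 'r trigger \<Rightarrow> bool" where
  "applicable_at k \<Sigma> Is ts i t \<longleftrightarrow> applicable k \<Sigma> (ts ` {..<i}) (Is i) t"

text \<open>Finite sequences must not stop while a trigger is still applicable, since
  a proper prefix of a chase is not meant to count as a non-terminating chase.
  Fairness constrains infinite sequences only.\<close>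

definition chase_seq ::
  "chase_kind \<Rightarrow> 'r tgd set \<Rightarrow> 'r inst \<Rightarrow> enat \<Rightarrow> (nat \<Rightarrow> 'r inst) \<Rightarrow> (nat \<Rightarrow> 'r trigger) \<Rightarrow> bool" where
  "chase_seq k \<Sigma> I N Is ts \<longleftrightarrow>
     Is 0 = I
     \<and> (\<forall>i. enat i < N \<longrightarrow> applicable_at k \<Sigma> Is ts i (ts i) \<and> fires (Is i) (ts i) (Is (Suc i)))
     \<and> (\<forall>n. N = enat n \<longrightarrow> \<not> (\<exists>t. applicable_at k \<Sigma> Is ts n t))
     \<and> (N = \<infinity> \<longrightarrow> (\<forall>i t. applicable_at k \<Sigma> Is ts i t \<longrightarrow>
          (\<exists>j\<ge>i. ts j = t \<or> \<not> applicable_at k \<Sigma> Is ts j t)))"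

definition terminates ::
  "chase_kind \<Rightarrow> 'r tgd set \<Rightarrow> enat \<Rightarrow> (nat \<Rightarrow> 'r inst) \<Rightarrow> (nat \<Rightarrow> 'r trigger) \<Rightarrow> bool" where
  "terminates k \<Sigma> N Is ts \<longleftrightarrow> (\<exists>i. enat i \<le> N \<and> \<not> (\<exists>t. applicable_at k \<Sigma> Is ts i t))"

definition CT :: "chase_kind \<Rightarrow> 'r schema \<Rightarrow> 'r tgd set set" where
  "CT k S = {\<Sigma>. is_tgd_set S \<Sigma> \<and>
     (\<forall>I. is_inst S I \<longrightarrow> (\<forall>N Is ts. chase_seq k \<Sigma> I N Is ts \<longrightarrow> terminates k \<Sigma> N Is ts))}"

text \<open>\<open>H \<xi>\<close> is the new relation symbol chosen for the tgd \<open>\<xi>\<close>.\<close>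

definition new_symbols :: "'r schema \<Rightarrow> 'r tgd set \<Rightarrow> ('r tgd \<Rightarrow> 'r) \<Rightarrow> bool" where
  "new_symbols S \<Sigma> H \<longleftrightarrow> inj_on H \<Sigma> \<and> H ` \<Sigma> \<inter> dom S = {}"

definition enrich :: "('r tgd \<Rightarrow> 'r) \<Rightarrow> 'r tgd \<Rightarrow> 'r tgd" where
  "enrich H \<xi> = Tgd (body \<xi>) (head \<xi> @ [Atom (H \<xi>) (map Var (frontier \<xi>))])"

definition semi_enrichment :: "('r tgd \<Rightarrow> 'r) \<Rightarrow> 'r tgd set \<Rightarrow> 'r tgd set" where
  "semi_enrichment H \<Sigma> = enrich H ` \<Sigma>"

definition enriched_schema :: "('r tgd \<Rightarrow> 'r) \<Rightarrow> 'r tgd set \<Rightarrow> 'r schema \<Rightarrow> 'r schema" where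
  "enriched_schema H \<Sigma> S =
     (\<lambda>r. if r \<in> H ` \<Sigma> then Some (length (frontier (inv_into \<Sigma> H r))) else S r)"

lemma ex_new_symbols:
  fixes S :: "'r schema"
  assumes "infinite (UNIV :: 'r set)" "is_schema S" "is_tgd_set S \<Sigma>"
  shows "\<exists>H. new_symbols S \<Sigma> H"
proof -
  have "infinite (- dom S)"
    using assms(1,2) by (simp add: is_schema_def Compl_eq_Diff_UNIV)
  then obtain A where A: "A \<subseteq> - dom S" "finite A" "card A = card \<Sigma>"
    using infinite_arbitrarily_large by metis
  have "finite \<Sigma>"
    using assms(3) by (simp add: is_tgd_set_def)
  then obtain H where "bij_betw H \<Sigma> A"
    using A finite_same_card_bij by metis
  with A show ?thesis
    by (auto simp: new_symbols_def bij_betw_def)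
qed

lemma enriched_schema_is_schema:
  assumes "is_schema S" "is_tgd_set S \<Sigma>"
  shows "is_schema (enriched_schema H \<Sigma> S)"
proof -
  have "dom (enriched_schema H \<Sigma> S) \<subseteq> H ` \<Sigma> \<union> dom S"
    by (auto simp: enriched_schema_def split: if_splits)
  with assms show ?thesis
    unfolding is_schema_def is_tgd_set_def by (meson finite_UnI finite_imageI finite_subset)
qed

lemma semi_enrichment_is_tgd_set:
  assumes "is_tgd_set S \<Sigma>" "new_symbols S \<Sigma> H"
  shows "is_tgd_set (enriched_schema H \<Sigma> S) (semi_enrichment H \<Sigma>)"
proof -
  have old: "atom_over (enriched_schema H \<Sigma> S) a" if "atom_over S a" for a :: "('a, tm) atom"
    using that assms(2) unfolding atom_over_def enriched_schema_def new_symbols_def by auto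
  have new: "atom_over (enriched_schema H \<Sigma> S) (Atom (H \<xi>) (map Var (frontier \<xi>)))"
    if "\<xi> \<in> \<Sigma>" for \<xi>
    using that assms(2) by (simp add: atom_over_def enriched_schema_def new_symbols_def)
  show ?thesis
    using assms(1) old new
    by (auto simp: is_tgd_set_def semi_enrichment_def tgd_over_def enrich_def)
qed

end

theory Submission imports Defs begin

text \<open>The atom \<open>H(h(x))\<close> produced by an enriched tgd records that the class of the trigger
  \<open>(\<xi>, h)\<close> has been fired. An infinite semi-oblivious chase with \<open>\<Sigma>\<close>, with these atoms added, is
  therefore a standard chase with the enrichment, and the two have the same applicable triggers at
  each step, so fairness carries over. Conversely, dropping the \<open>H\<close>-atoms from an infinite standard
  chase gives an infinite semi-oblivious run. It need not be fair: \<open>H\<close>-atoms of the initial instance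
  may block classes forever. But some fair semi-oblivious chase exists, and if it terminates
  after \<open>n\<close> steps then every run, fair or not, embeds into it and so has at most \<open>n\<close> steps.\<close>

section \<open>Variables of tgds, assignments and values of instances\<close>

lemma set_frontier: "set (frontier \<xi>) = univ_vars \<xi> \<inter> set (conj_vars (head \<xi>))"
  by (auto simp: frontier_def univ_vars_def)

lemma head_vars: "set (conj_vars (head \<xi>)) = set (frontier \<xi>) \<union> exist_vars \<xi>"
  by (auto simp: set_frontier exist_vars_def univ_vars_def)

lemma univ_exist_disjoint: "univ_vars \<xi> \<inter> exist_vars \<xi> = {}"
  by (auto simp: univ_vars_def exist_vars_def)

lemma trigger_equiv_iff:
  "trigger_equiv s t \<longleftrightarrow> fst s = fst t \<and> (\<forall>v \<in> set (frontier (fst t)). snd s v = snd t v)"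
  by (auto simp: trigger_equiv_def)

lemma set_conj_vars: "v \<in> set (conj_vars as) \<longleftrightarrow> (\<exists>a\<in>set as. Var v \<in> set (args a))"
proof -
  have "v \<in> set (tm_vars x) \<longleftrightarrow> x = Var v" for x by (cases x) auto
  then show ?thesis by (auto simp: conj_vars_def)
qed

lemma app_conj_cong:
  assumes "\<And>v. v \<in> set (conj_vars as) \<Longrightarrow> h v = h' v"
  shows "app_conj h as = app_conj h' as"
proof -
  have "app_tm h x = app_tm h' x" if "a \<in> set as" "x \<in> set (args a)" for a x
    using that assms unfolding set_conj_vars by (cases x) (simp, metis, simp)
  then show ?thesis unfolding app_conj_def by (intro image_cong) auto
qed

lemma val_in_inst_vals:
  assumes "v \<in> set (conj_vars as)" "app_conj h as \<subseteq> I"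
  shows "the (h v) \<in> inst_vals I"
proof -
  obtain a where a: "a \<in> set as" "Var v \<in> set (args a)"
    using assms(1) by (auto simp: set_conj_vars)
  then have "Atom (rel a) (map (app_tm h) (args a)) \<in> I"
    using assms(2) by (auto simp: app_conj_def)
  moreover have "the (h v) \<in> set (map (app_tm h) (args a))"
    using a(2) by force
  ultimately show ?thesis unfolding inst_vals_def by force
qed

lemma inst_vals_app_conj:
  "inst_vals (app_conj h as) \<subseteq> (\<lambda>v. the (h v)) ` set (conj_vars as) \<union> range Const"
proof
  fix w assume "w \<in> inst_vals (app_conj h as)"
  then obtain a x where "a \<in> set as" "x \<in> set (args a)" "w = app_tm h x"
    by (auto simp: inst_vals_def app_conj_def)
  then show "w \<in> (\<lambda>v. the (h v)) ` set (conj_vars as) \<union> range Const"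
    using set_conj_vars[of _ as] by (cases x) (fastforce, simp)
qed

lemma inst_vals_Un [simp]: "inst_vals (I \<union> J) = inst_vals I \<union> inst_vals J"
  by (simp add: inst_vals_def)

lemma inst_vals_mono: "I \<subseteq> J \<Longrightarrow> inst_vals I \<subseteq> inst_vals J"
  by (auto simp: inst_vals_def)

lemma map_atom_app_conj:
  assumes "\<And>c. g (Const c) = Const c"
    and "\<And>v. v \<in> set (conj_vars as) \<Longrightarrow> the (h' v) = g (the (h v))"
  shows "map_atom id g ` app_conj h as = app_conj h' as"
proof -
  have *: "g (app_tm h x) = app_tm h' x" if "a \<in> set as" "x \<in> set (args a)" for a x
    using that assms(1) assms(2) unfolding set_conj_vars by (cases x) (simp, metis, simp)
  have "map_atom id g (Atom (rel a) (map (app_tm h) (args a)))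
      = Atom (rel a) (map (app_tm h') (args a))" if "a \<in> set as" for a
    using *[OF that] by simp
  then show ?thesis
    unfolding app_conj_def image_image by (rule image_cong[OF refl])
qed

lemma map_atom_cong_vals:
  assumes "\<And>w. w \<in> inst_vals I \<Longrightarrow> g w = g' w"
  shows "map_atom id g ` I = map_atom id g' ` I"
proof (intro image_cong refl)
  fix a assume "a \<in> I"
  then show "map_atom id g a = map_atom id g' a"
    using assms by (cases a) (force simp: inst_vals_def)
qed

text \<open>A head variable is either existential or in the frontier. Keeping \<open>e\<close> on
  the existential variables and taking \<open>t\<close> on the universal ones therefore leaves the
  head image unchanged, since \<open>s\<close> and \<open>t\<close> agree on the frontier. The
  result is an extension of \<open>t\<close> that refutes activity.\<close>

lemma not_active_if_equiv:
  assumes "trigger_equiv s t" "is_extension s e" "app_conj e (head (fst s)) \<subseteq> I"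
    and "dom (snd t) = univ_vars (fst t)"
  shows "\<not> active I t"
proof -
  define \<xi> where "\<xi> = fst t"
  have st: "fst s = \<xi>" "\<And>v. v \<in> set (frontier \<xi>) \<Longrightarrow> snd s v = snd t v"
    using assms(1) by (auto simp: trigger_equiv_iff \<xi>_def)
  have e: "dom e = univ_vars \<xi> \<union> exist_vars \<xi>" "snd s \<subseteq>\<^sub>m e"
    using assms(2) st(1) by (cases s; simp add: is_extension_def)+
  define e' where "e' = (\<lambda>v. if v \<in> exist_vars \<xi> then e v else snd t v)"
  have "is_extension t e'"
    using e(1) assms(4) univ_exist_disjoint[of \<xi>]
    by (cases t) (auto simp: is_extension_def e'_def map_le_def \<xi>_def dom_def split: if_splits)
  moreover have "e' v = e v" if "v \<in> set (conj_vars (head \<xi>))" for v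
  proof (cases "v \<in> exist_vars \<xi>")
    case False
    then have v: "v \<in> set (frontier \<xi>)" using that head_vars by auto
    then have "v \<in> dom (snd t)" using assms(4) by (auto simp: set_frontier \<xi>_def)
    then have "v \<in> dom (snd s)" using st(2)[OF v] by (auto simp: dom_def)
    then show ?thesis using False e(2) st(2)[OF v] by (auto simp: e'_def map_le_def)
  qed (simp add: e'_def)
  then have "app_conj e' (head \<xi>) = app_conj e (head \<xi>)" by (rule app_conj_cong)
  ultimately show ?thesis using assms(3) st(1) unfolding active_def \<xi>_def by auto
qed

lemma inj_on_disjoint_Un:
  "inj_on f B \<Longrightarrow> inj_on f A \<Longrightarrow> f ` A \<inter> f ` B = {} \<Longrightarrow> inj_on f (A \<union> B)"
  unfolding inj_on_Un by blast

section \<open>Runs\<close>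

text \<open>The witness that \<open>fires\<close> hides behind an existential quantifier, named so
  that the nulls created at each step can be tracked.\<close>

definition fresh_extension :: "'r inst \<Rightarrow> 'r trigger \<Rightarrow> (nat \<rightharpoonup> val) \<Rightarrow> bool" where
  "fresh_extension I t e \<longleftrightarrow> is_extension t e \<and> inj_on e (exist_vars (fst t))
     \<and> (\<forall>z \<in> exist_vars (fst t). \<exists>n. e z = Some (Null n) \<and> Null n \<notin> inst_vals I)"

lemma fires_iff:
  "fires I t J \<longleftrightarrow> (\<exists>e. fresh_extension I t e \<and> J = I \<union> app_conj e (head (fst t)))"
  by (auto simp: fires_def fresh_extension_def)

text \<open>Unlike a chase sequence, a run need be neither fair nor maximal.\<close>

definition run ::
  "chase_kind \<Rightarrow> 'r tgd set \<Rightarrow> enat \<Rightarrow> (nat \<Rightarrow> 'r inst) \<Rightarrow> (nat \<Rightarrow> 'r trigger) \<Rightarrow> (nat \<Rightarrow> nat \<rightharpoonup> val) \<Rightarrow> bool"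
  where "run k \<Sigma> N Is ts es \<longleftrightarrow> (\<forall>i. enat i < N \<longrightarrow>
     applicable_at k \<Sigma> Is ts i (ts i) \<and> fresh_extension (Is i) (ts i) (es i)
     \<and> Is (Suc i) = Is i \<union> app_conj (es i) (head (fst (ts i))))"

text \<open>By the axiom of choice, the witnesses of the individual firings form one sequence
  \<open>es\<close>.\<close>

lemma ex_run_iff:
  "(\<exists>es. run k \<Sigma> N Is ts es) \<longleftrightarrow>
     (\<forall>i. enat i < N \<longrightarrow> applicable_at k \<Sigma> Is ts i (ts i) \<and> fires (Is i) (ts i) (Is (Suc i)))"
  unfolding run_def fires_iff by (subst choice_iff[symmetric]) blast

lemma chase_seq_run:
  assumes "chase_seq k \<Sigma> I N Is ts"
  obtains es where "run k \<Sigma> N Is ts es"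
proof -
  have "\<exists>es. run k \<Sigma> N Is ts es"
    unfolding ex_run_iff using assms by (auto simp: chase_seq_def)
  with that show thesis by blast
qed

text \<open>A finite sequence has to end without an applicable trigger, while an infinite one fires
  an applicable trigger at every step.\<close>

lemma terminates_iff_finite:
  assumes "chase_seq k \<Sigma> I N Is ts"
  shows "terminates k \<Sigma> N Is ts \<longleftrightarrow> N \<noteq> \<infinity>"
proof (cases N)
  case infinity
  with assms have "applicable_at k \<Sigma> Is ts i (ts i)" for i by (simp add: chase_seq_def)
  with infinity show ?thesis unfolding terminates_def by blast
qed (use assms in \<open>auto simp: chase_seq_def terminates_def\<close>)

lemma CT_iff:
  "\<Sigma> \<in> CT k S \<longleftrightarrow> is_tgd_set S \<Sigma> \<and> (\<forall>I Is ts. is_inst S I \<longrightarrow> \<not> chase_seq k \<Sigma> I \<infinity> Is ts)"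
proof -
  have "(\<forall>N Is ts. chase_seq k \<Sigma> I N Is ts \<longrightarrow> terminates k \<Sigma> N Is ts) \<longleftrightarrow>
      (\<forall>Is ts. \<not> chase_seq k \<Sigma> I \<infinity> Is ts)" for I
    using terminates_iff_finite by metis
  then show ?thesis unfolding CT_def by blast
qed

lemma applicable_at_trigger:
  assumes "applicable_at k \<Sigma> Is ts i t"
  shows "fst t \<in> \<Sigma>" "dom (snd t) = univ_vars (fst t)" "app_conj (snd t) (body (fst t)) \<subseteq> Is i"
  using assms by (cases k; cases t; simp add: applicable_at_def is_trigger_def)+

lemma fresh_extension_dest:
  assumes "fresh_extension I t e" "dom (snd t) = univ_vars (fst t)"
  shows "is_extension t e"
    and "v \<in> univ_vars (fst t) \<Longrightarrow> e v = snd t v"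
    and "z \<in> exist_vars (fst t) \<Longrightarrow> \<exists>n. e z = Some (Null n) \<and> Null n \<notin> inst_vals I"
    and "inj_on e (exist_vars (fst t))"
  using assms by (auto simp: fresh_extension_def is_extension_def map_le_def split: prod.splits)

lemma run_mono:
  assumes "run k \<Sigma> N Is ts es" "i \<le> j" "enat j \<le> N"
  shows "Is i \<subseteq> Is j"
  using assms(2,3)
proof (induction j rule: dec_induct)
  case (step j)
  then have "enat j < N" by (metis Suc_ile_eq)
  then have "Is j \<subseteq> Is (Suc j)" using assms(1) by (auto simp: run_def)
  with step show ?case using \<open>enat j < N\<close> by (auto dest: order.strict_implies_order)
qed simp

lemma run_head:
  assumes "run k \<Sigma> N Is ts es" "i < j" "enat j \<le> N"
  shows "app_conj (es i) (head (fst (ts i))) \<subseteq> Is j"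
proof -
  have i: "enat i < N" using assms(2,3) by (meson enat_ord_simps(2) less_le_trans)
  have "Is (Suc i) \<subseteq> Is j" using run_mono[OF assms(1)] assms(2,3) by simp
  with i assms(1) show ?thesis by (auto simp: run_def)
qed

lemma run_exist_val:
  assumes "run k \<Sigma> N Is ts es" "i < j" "enat j \<le> N" "z \<in> exist_vars (fst (ts i))"
  shows "the (es i z) \<in> inst_vals (Is j)"
  using run_head[OF assms(1-3)] assms(4) head_vars by (intro val_in_inst_vals) auto

lemma run_exist_null:
  assumes "run k \<Sigma> N Is ts es" "enat i < N" "z \<in> exist_vars (fst (ts i))"
  obtains n where "es i z = Some (Null n)" "Null n \<notin> inst_vals (Is i)"
  using assms unfolding run_def fresh_extension_def by blast

text \<open>A null created at step \<open>i\<close> occurs in all later instances, whereas a null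
  created at step \<open>j\<close> is absent from \<open>Is j\<close>. So nulls of different steps
  differ; within one step, \<open>es i\<close> is injective on the existential variables.\<close>

lemma run_exist_inj:
  assumes r: "run k \<Sigma> N Is ts es" and i: "enat i < N" and j: "enat j < N"
    and z: "z \<in> exist_vars (fst (ts i))" "w \<in> exist_vars (fst (ts j))"
    and eq: "es i z = es j w"
  shows "i = j \<and> z = w"
proof -
  have less: "es i z \<noteq> es j w" if "i < j" "enat j < N"
    "z \<in> exist_vars (fst (ts i))" "w \<in> exist_vars (fst (ts j))" for i j z w
  proof -
    have "the (es i z) \<in> inst_vals (Is j)"
      using run_exist_val[OF r] that by simp
    moreover obtain n where "es j w = Some (Null n)" "Null n \<notin> inst_vals (Is j)"
      using run_exist_null[OF r] \<open>enat j < N\<close> \<open>w \<in> exist_vars (fst (ts j))\<close> by blast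
    ultimately show ?thesis by auto
  qed
  have "i = j"
    using less[of i j z w] less[of j i w z] i j z eq by (metis linorder_neqE_nat)
  moreover have "inj_on (es i) (exist_vars (fst (ts i)))"
    using r i by (auto simp: run_def fresh_extension_def)
  ultimately show ?thesis using z eq by (auto dest: inj_onD)
qed

section \<open>Comparison of semi-oblivious runs with a terminating chase\<close>

lemma sobl_run_not_equiv:
  assumes "run Sobl \<Sigma> N Is ts es" "i < j" "enat j < N"
  shows "\<not> trigger_equiv (ts i) (ts j)"
  using assms by (auto simp: run_def applicable_at_def)


text \<open>A terminating semi-oblivious chase bounds the length of all runs from the same instance:
  the run is embedded step by step into the chase, by a map \<open>g\<close> on values that is injective and
  hence sends inequivalent triggers to inequivalent ones.\<close>

lemma sobl_run_embeds:
  assumes c: "chase_seq Sobl \<Sigma> I (enat n) Is ts" and e: "run Sobl \<Sigma> (enat n) Is ts es"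
    and r: "run Sobl \<Sigma> \<infinity> Is' ts' es'" and init: "Is' 0 = I"
  shows "\<exists>g p. (\<forall>c. g (Const c) = Const c)
     \<and> inj_on g (inst_vals (Is' m) \<union> range Const)
     \<and> g ` inst_vals (Is' m) \<subseteq> inst_vals I \<union> range Const
         \<union> {the (es (p i) z) | i z. i < m \<and> z \<in> exist_vars (fst (ts (p i)))}
     \<and> map_atom id g ` Is' m \<subseteq> Is n
     \<and> (\<forall>i<m. p i < n \<and> fst (ts (p i)) = fst (ts' i)
          \<and> (\<forall>v \<in> set (frontier (fst (ts' i))). snd (ts (p i)) v = map_option g (snd (ts' i) v)))
     \<and> inj_on p {..<m}"
\<comment> \<open>Step \<open>i\<close> of the run is matched with step \<open>p i\<close> of the
  chase. The bound on the image of \<open>g\<close> says that every value hit is initial, a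
  constant, or created at a matched chase step; it keeps the nulls of an unmatched step free as new
  targets, which preserves injectivity.\<close>
proof (induction m)
  case 0
  have "Is 0 = I" using c by (simp add: chase_seq_def)
  moreover have "Is 0 \<subseteq> Is n" using run_mono[OF e] by simp
  ultimately show ?case by (intro exI[of _ id]) (simp add: init atom.map_ident)
next
  case (Suc m)
  from Suc.IH obtain g p where gC': "\<forall>c. g (Const c) = Const c"
    and ginj: "inj_on g (inst_vals (Is' m) \<union> range Const)"
    and gim: "g ` inst_vals (Is' m) \<subseteq> inst_vals I \<union> range Const
         \<union> {the (es (p i) z) | i z. i < m \<and> z \<in> exist_vars (fst (ts (p i)))}"
    and ghom: "map_atom id g ` Is' m \<subseteq> Is n"
    and p': "\<forall>i<m. p i < n \<and> fst (ts (p i)) = fst (ts' i)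
          \<and> (\<forall>v \<in> set (frontier (fst (ts' i))). snd (ts (p i)) v = map_option g (snd (ts' i) v))"
    and pinj: "inj_on p {..<m}"
    by (elim exE conjE) (rule that)
  have gC: "\<And>c. g (Const c) = Const c" using gC' by (rule spec)
  have p: "\<And>i. i < m \<Longrightarrow> p i < n" "\<And>i. i < m \<Longrightarrow> fst (ts (p i)) = fst (ts' i)"
    "\<And>i v. i < m \<Longrightarrow> v \<in> set (frontier (fst (ts' i))) \<Longrightarrow>
        snd (ts (p i)) v = map_option g (snd (ts' i) v)"
    using p' by simp_all
  obtain \<xi> h where t: "ts' m = (\<xi>, h)" by (cases "ts' m")
  have app': "applicable_at Sobl \<Sigma> Is' ts' i (ts' i)" for i using r by (simp add: run_def)
  note tr = applicable_at_trigger[OF app']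
  have fe: "fresh_extension (Is' m) (ts' m) (es' m)" using r by (simp add: run_def)
  note fe' = fresh_extension_dest[OF fe tr(2)]
  define E where "E = exist_vars \<xi>"
  \<comment> \<open>The image of the run's trigger under \<open>g\<close> is a trigger on the last
    chase instance \<open>Is n\<close>. Nothing is applicable there, so its class was fired at some
    chase step \<open>k\<close>, which becomes the partner of step \<open>m\<close>.\<close>
  define h' where "h' = map_option g \<circ> h"
  have domh: "dom h = univ_vars \<xi>" using tr(2)[of m] t by simp
  have "app_conj h' (body \<xi>) = map_atom id g ` app_conj h (body \<xi>)"
  proof (rule map_atom_app_conj[OF gC, symmetric])
    fix v assume "v \<in> set (conj_vars (body \<xi>))"
    then have "v \<in> dom h" using domh by (simp add: univ_vars_def)
    then show "the (h' v) = g (the (h v))" by (auto simp: h'_def)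
  qed
  then have "is_trigger \<Sigma> (Is n) (\<xi>, h')"
    using tr[of m] t ghom domh by (auto simp: is_trigger_def h'_def)
  moreover have "\<not> applicable_at Sobl \<Sigma> Is ts n (\<xi>, h')"
    using c by (simp add: chase_seq_def)
  ultimately obtain k where k: "k < n" "trigger_equiv (ts k) (\<xi>, h')"
    by (auto simp: applicable_at_def)
  then have k\<xi>: "fst (ts k) = \<xi>"
    and kfr: "\<And>v. v \<in> set (frontier \<xi>) \<Longrightarrow> snd (ts k) v = map_option g (h v)"
    by (auto simp: trigger_equiv_iff h'_def)
  \<comment> \<open>Frontier values of the run lie where \<open>g\<close> is injective, so
    equalities between their images can be cancelled.\<close>
  have frval: "\<exists>w. snd (ts' i) v = Some w \<and> w \<in> inst_vals (Is' m)"
    if "i \<le> m" "v \<in> set (frontier (fst (ts' i)))" for i v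
  proof -
    have v: "v \<in> univ_vars (fst (ts' i))" using that by (simp add: set_frontier)
    then have "the (snd (ts' i) v) \<in> inst_vals (Is' i)"
      using tr(3)[of i] by (intro val_in_inst_vals) (simp_all add: univ_vars_def)
    moreover have "Is' i \<subseteq> Is' m" using run_mono[OF r] that(1) by simp
    ultimately have "the (snd (ts' i) v) \<in> inst_vals (Is' m)" using inst_vals_mono by blast
    moreover have "v \<in> dom (snd (ts' i))" using v tr(2) by simp
    ultimately show ?thesis by auto
  qed
  \<comment> \<open>If \<open>k\<close> were already matched with step \<open>i\<close>, cancelling
    \<open>g\<close> on the frontier would make \<open>ts' i\<close> and \<open>ts' m\<close>
    equivalent, although a semi-oblivious run fires each class once.\<close>
  have knew: "p i \<noteq> k" if i: "i < m" for i
  proof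
    assume "p i = k"
    have f: "fst (ts' i) = \<xi>" using p(2)[OF i] \<open>p i = k\<close> k\<xi> by simp
    have "snd (ts' i) v = h v" if v: "v \<in> set (frontier \<xi>)" for v
    proof -
      obtain w where w: "snd (ts' i) v = Some w" "w \<in> inst_vals (Is' m)"
        using frval[of i v] i v f by auto
      obtain w' where w': "h v = Some w'" "w' \<in> inst_vals (Is' m)"
        using frval[of m v] v t by auto
      have "map_option g (snd (ts' i) v) = map_option g (h v)"
        using p(3)[OF i, of v] kfr[OF v] v f \<open>p i = k\<close> by simp
      then show ?thesis using w w' ginj by (auto dest: inj_onD)
    qed
    then have "trigger_equiv (ts' i) (ts' m)" using f t by (simp add: trigger_equiv_iff)
    then show False using sobl_run_not_equiv[OF r i] by simp
  qed
  have appk: "applicable_at Sobl \<Sigma> Is ts k (ts k)" "fresh_extension (Is k) (ts k) (es k)"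
    using e k(1) by (simp_all add: run_def)
  note ek = fresh_extension_dest[OF appk(2) applicable_at_trigger(2)[OF appk(1)], unfolded k\<xi>]
  note em = fe'[unfolded t fst_conv snd_conv]
  \<comment> \<open>A null created by the run at step \<open>m\<close> goes to the null that chase
    step \<open>k\<close> created for the same existential variable; all other values keep their
    image. The choice is unique because \<open>es' m\<close> is injective on
    \<open>E\<close>.\<close>
  define g' where "g' w = (if \<exists>z\<in>E. es' m z = Some w
      then the (es k (SOME z. z \<in> E \<and> es' m z = Some w)) else g w)" for w
  have g'E: "g' (the (es' m z)) = the (es k z)" if z: "z \<in> E" for z
  proof -
    obtain w where w: "es' m z = Some w" using em(3) z E_def by blast
    have "z' = z" if "z' \<in> E \<and> es' m z' = Some w" for z'
      using em(4)[folded E_def] that z w by (metis inj_onD)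
    then have "(SOME z. z \<in> E \<and> es' m z = Some w) = z"
      using z w by (intro some_equality conjI)
    then show ?thesis using z w by (auto simp: g'_def)
  qed
  have g'old: "g' w = g w" if w: "w \<in> inst_vals (Is' m) \<union> range Const" for w
  proof -
    have "es' m z \<noteq> Some w" if z: "z \<in> E" for z
    proof -
      obtain a where a: "es' m z = Some (Null a)" "Null a \<notin> inst_vals (Is' m)"
        using em(3) z unfolding E_def by blast
      then have "w \<noteq> Null a" using w by blast
      then show ?thesis using a(1) by simp
    qed
    then show ?thesis by (simp add: g'_def)
  qed
  have g'C: "g' (Const c) = Const c" for c using g'old[of "Const c"] gC by simp
  have SucIs: "Is' (Suc m) = Is' m \<union> app_conj (es' m) (head \<xi>)"
    using r t by (simp add: run_def)
  have frm: "es' m v = h v" "es k v = snd (ts k) v" "\<exists>w. h v = Some w \<and> w \<in> inst_vals (Is' m)"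
    if "v \<in> set (frontier \<xi>)" for v
  proof -
    have "v \<in> univ_vars \<xi>" using that by (simp add: set_frontier)
    then show "es' m v = h v" "es k v = snd (ts k) v" by (rule em(2), rule ek(2))
    show "\<exists>w. h v = Some w \<and> w \<in> inst_vals (Is' m)" using frval[of m v] that t by simp
  qed
  have vals: "inst_vals (Is' (Suc m)) \<union> range Const \<subseteq>
      (inst_vals (Is' m) \<union> range Const) \<union> (\<lambda>z. the (es' m z)) ` E"
  proof -
    have "(\<lambda>v. the (es' m v)) ` set (frontier \<xi>) \<subseteq> inst_vals (Is' m)"
      using frm(1,3) by force
    then show ?thesis
      using inst_vals_app_conj[of "es' m" "head \<xi>"]
      unfolding SucIs head_vars E_def[symmetric] inst_vals_Un image_Un by blast
  qed
  \<comment> \<open>The new targets avoid the old image: they are nulls, they are fresh for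
    \<open>Is k\<close> and hence absent from \<open>I\<close>, and they were created at a step
    other than every \<open>p i\<close> with \<open>i < m\<close>.\<close>
  have kE: "the (es k z) \<notin> g ` (inst_vals (Is' m) \<union> range Const)" if z: "z \<in> E" for z
  proof -
    obtain a where a: "es k z = Some (Null a)" "Null a \<notin> inst_vals (Is k)"
      using ek(3) z E_def by blast
    have "I \<subseteq> Is k" using run_mono[OF e, of 0 k] c k(1) by (simp add: chase_seq_def)
    then have "Null a \<notin> inst_vals I" using a(2) inst_vals_mono by blast
    moreover have "the (es (p i) z') \<noteq> Null a"
      if i: "i < m" and z': "z' \<in> exist_vars (fst (ts (p i)))" for i z'
    proof
      assume *: "the (es (p i) z') = Null a"
      have "enat (p i) < enat n" using p(1)[OF i] by simp
      then obtain b where "es (p i) z' = Some (Null b)"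
        using run_exist_null[OF e _ z'] by metis
      then have "es (p i) z' = es k z" using * a(1) by simp
      then have "p i = k"
        using run_exist_inj[OF e, of "p i" k z' z] p(1)[OF i] k(1) z' z k\<xi> by (simp add: E_def)
      then show False using knew[OF i] by simp
    qed
    ultimately have "Null a \<notin> g ` inst_vals (Is' m)" using gim by fastforce
    then show ?thesis using a(1) by (auto simp: gC)
  qed
  have "inj_on (\<lambda>z. the (es k z)) E"
  proof (rule inj_onI)
    fix y z assume yz: "y \<in> E" "z \<in> E" "the (es k y) = the (es k z)"
    have "es k y \<noteq> None" "es k z \<noteq> None" using ek(3) yz(1,2) unfolding E_def by force+
    with yz(3) have "es k y = es k z" by auto
    then show "y = z" by (rule inj_onD[OF ek(4)[folded E_def] _ yz(1,2)])
  qed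
  then have kinj: "y = z" if "the (es k y) = the (es k z)" "y \<in> E" "z \<in> E" for y z
    using that by (rule inj_onD)
  have "inj_on g' ((\<lambda>z. the (es' m z)) ` E)"
  proof (rule inj_onI)
    fix a b assume "a \<in> (\<lambda>z. the (es' m z)) ` E" "b \<in> (\<lambda>z. the (es' m z)) ` E" and ab: "g' a = g' b"
    then obtain y z where yz: "a = the (es' m y)" "b = the (es' m z)" "y \<in> E" "z \<in> E" by blast
    then have "the (es k y) = the (es k z)" using ab g'E by simp
    then have "y = z" using yz(3,4) by (rule kinj)
    then show "a = b" using yz(1,2) by simp
  qed
  moreover have "inj_on g' (inst_vals (Is' m) \<union> range Const)"
  proof -
    have "inj_on g' (inst_vals (Is' m) \<union> range Const) = inj_on g (inst_vals (Is' m) \<union> range Const)"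
      by (rule inj_on_cong) (erule g'old)
    then show ?thesis using ginj by (rule iffD2)
  qed
  moreover have "g' ` (inst_vals (Is' m) \<union> range Const) \<inter> g' ` (\<lambda>z. the (es' m z)) ` E = {}"
  proof -
    have "g' ` (inst_vals (Is' m) \<union> range Const) = g ` (inst_vals (Is' m) \<union> range Const)"
      by (rule image_cong[OF refl]) (erule g'old)
    moreover have "g' ` (\<lambda>z. the (es' m z)) ` E = (\<lambda>z. the (es k z)) ` E"
      unfolding image_image by (rule image_cong[OF refl]) (erule g'E)
    moreover have "g ` (inst_vals (Is' m) \<union> range Const) \<inter> (\<lambda>z. the (es k z)) ` E = {}"
    proof (intro equals0I, elim IntE)
      fix b assume b: "b \<in> g ` (inst_vals (Is' m) \<union> range Const)" "b \<in> (\<lambda>z. the (es k z)) ` E"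
      from b(2) show False by (rule imageE) (use kE b(1) in simp)
    qed
    ultimately show ?thesis by simp
  qed
  ultimately have "inj_on g' ((inst_vals (Is' m) \<union> range Const) \<union> (\<lambda>z. the (es' m z)) ` E)"
    by (rule inj_on_disjoint_Un)
  then have 1: "inj_on g' (inst_vals (Is' (Suc m)) \<union> range Const)"
    using vals by (rule inj_on_subset)
  define p' where "p' = p(m := k)"
  have 2: "g' ` inst_vals (Is' (Suc m)) \<subseteq> inst_vals I \<union> range Const
         \<union> {the (es (p' i) z) | i z. i < Suc m \<and> z \<in> exist_vars (fst (ts (p' i)))}" (is "_ \<subseteq> ?R")
  proof -
    have sub: "inst_vals I \<union> range Const
         \<union> {the (es (p i) z) | i z. i < m \<and> z \<in> exist_vars (fst (ts (p i)))} \<subseteq> ?R"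
    proof (intro Un_mono order_refl subsetI, elim CollectE exE conjE)
      fix x i z assume "x = the (es (p i) z)" "i < m" "z \<in> exist_vars (fst (ts (p i)))"
      then have "x = the (es (p' i) z) \<and> i < Suc m \<and> z \<in> exist_vars (fst (ts (p' i)))"
        by (simp add: p'_def)
      then show "x \<in> {the (es (p' i) z) | i z. i < Suc m \<and> z \<in> exist_vars (fst (ts (p' i)))}"
        unfolding mem_Collect_eq by (intro exI)
    qed
    show ?thesis
    proof (rule image_subsetI)
      fix w assume "w \<in> inst_vals (Is' (Suc m))"
      then have "w \<in> (inst_vals (Is' m) \<union> range Const) \<union> (\<lambda>z. the (es' m z)) ` E"
        by (rule subsetD[OF vals UnI1])
      then show "g' w \<in> ?R"
      proof (elim UnE)
        assume 1: "w \<in> inst_vals (Is' m)"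
        then have "g w \<in> ?R" by (rule subsetD[OF sub subsetD[OF gim imageI]])
        then show ?thesis unfolding g'old[OF UnI1[OF 1]] .
      next
        assume 2: "w \<in> range Const"
        then obtain c where "w = Const c" by (rule imageE)
        then have "g' w = Const c" using g'old[OF UnI2[OF 2]] gC by simp
        then have "g' w \<in> range Const" by simp
        then show ?thesis by (rule UnI1[OF UnI2])
      next
        assume "w \<in> (\<lambda>z. the (es' m z)) ` E"
        then obtain z where z: "w = the (es' m z)" "z \<in> E" by (rule imageE)
        then have "g' w = the (es (p' m) z) \<and> m < Suc m \<and> z \<in> exist_vars (fst (ts (p' m)))"
          using g'E[OF z(2)] k\<xi> by (simp add: p'_def E_def)
        then have "\<exists>i z. g' w = the (es (p' i) z) \<and> i < Suc m \<and> z \<in> exist_vars (fst (ts (p' i)))"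
          by (intro exI)
        then show ?thesis unfolding Un_iff mem_Collect_eq by (rule disjI2)
      qed
    qed
  qed
  \<comment> \<open>On the frontier both sides agree by the equivalence of \<open>ts k\<close> with
    the image trigger, on \<open>E\<close> by the choice of \<open>g'\<close>.\<close>
  have "map_atom id g' ` app_conj (es' m) (head \<xi>) = app_conj (es k) (head \<xi>)"
  proof (rule map_atom_app_conj)
    fix v assume "v \<in> set (conj_vars (head \<xi>))"
    then consider "v \<in> E" | "v \<in> set (frontier \<xi>)" using head_vars by (auto simp: E_def)
    then show "the (es k v) = g' (the (es' m v))"
    proof cases
      case 2
      then show ?thesis using frm[OF 2] kfr[OF 2] g'old by auto
    qed (simp add: g'E)
  qed (rule g'C)
  moreover have "app_conj (es k) (head \<xi>) \<subseteq> Is n"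
    using run_head[OF e k(1)] k\<xi> by simp
  moreover have "map_atom id g' ` Is' m = map_atom id g ` Is' m"
    using g'old by (intro map_atom_cong_vals) auto
  ultimately have 3: "map_atom id g' ` Is' (Suc m) \<subseteq> Is n"
    using ghom unfolding SucIs image_Un by simp
  have 4: "snd (ts (p' i)) v = map_option g' (snd (ts' i) v)"
    if i: "i < Suc m" and v: "v \<in> set (frontier (fst (ts' i)))" for i v
  proof -
    obtain w where w: "snd (ts' i) v = Some w" "w \<in> inst_vals (Is' m)"
      using frval[OF less_Suc_eq_le[THEN iffD1, OF i] v] by blast
    then have "map_option g' (snd (ts' i) v) = map_option g (snd (ts' i) v)"
      using g'old by simp
    then show ?thesis
      using i v p(3)[of i v] kfr[of v] t by (cases "i = m") (auto simp: p'_def)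
  qed
  have 5: "inj_on p' {..<Suc m}"
  proof -
    have k': "k \<notin> p ` {..<m}"
    proof
      assume "k \<in> p ` {..<m}"
      then obtain i where "k = p i" "i < m" by blast
      then show False using knew[of i] by simp
    qed
    moreover have "p' ` {..<m} = p ` {..<m}" by (simp add: p'_def)
    moreover have "inj_on p' {..<m}" unfolding p'_def by (rule inj_on_fun_updI[OF pinj k'])
    moreover have "p' m = k" by (simp add: p'_def)
    ultimately show ?thesis by (simp add: lessThan_Suc)
  qed
  have 6: "p' i < n" "fst (ts (p' i)) = fst (ts' i)" if "i < Suc m" for i
    using that p(1,2)[of i] k(1) k\<xi> t by (auto simp: p'_def less_Suc_eq)
  show ?case
    by (intro exI[of _ g'] exI[of _ p'] conjI allI impI ballI g'C 1 2 3 4 5 6)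
qed

text \<open>Pigeonhole: the first \<open>n + 1\<close> steps of the run would be matched injectively
  with only \<open>n\<close> chase steps.\<close>

lemma sobl_no_infinite_run:
  assumes "chase_seq Sobl \<Sigma> I (enat n) Is ts" "run Sobl \<Sigma> \<infinity> Is' ts' es'" "Is' 0 = I"
  shows False
proof -
  obtain es where "run Sobl \<Sigma> (enat n) Is ts es" using chase_seq_run[OF assms(1)] .
  from sobl_run_embeds[OF assms(1) this assms(2,3), of "Suc n"]
  obtain p :: "nat \<Rightarrow> nat" where "inj_on p {..<Suc n}" "\<forall>i<Suc n. p i < n" by blast
  then have "inj_on p {..<Suc n}" "p ` {..<Suc n} \<subseteq> {..<n}" by auto
  then have "card {..<Suc n} \<le> card {..<n}" by (rule card_inj_on_le) simp
  then show False by simp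
qed


section \<open>Existence of fair semi-oblivious chase sequences\<close>

text \<open>A finite instance contains finitely many nulls. With \<open>M\<close> above all their
  indices, each existential variable \<open>z\<close> receives \<open>Null (M + z)\<close>; these
  are fresh and pairwise distinct.\<close>

lemma ex_fires:
  assumes "finite I" "dom (snd t) = univ_vars (fst t)"
  shows "\<exists>J. fires I t J"
proof -
  have "finite (inst_vals I)" using assms(1) by (simp add: inst_vals_def)
  then have "finite (Null -` inst_vals I)" by (rule finite_vimageI) (simp add: inj_def)
  then obtain M where M: "\<forall>n \<in> Null -` inst_vals I. n < M"
    unfolding finite_nat_set_iff_bounded by (rule exE)
  have fresh: "Null (M + v) \<notin> inst_vals I" for v
  proof
    assume "Null (M + v) \<in> inst_vals I"
    then have "M + v < M" using M by (intro bspec[OF M]) simp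
    then show False by simp
  qed
  define e where "e v = (if v \<in> exist_vars (fst t) then Some (Null (M + v)) else snd t v)" for v
  have "dom e = dom (snd t) \<union> exist_vars (fst t)"
    by (auto simp: e_def split: if_splits)
  moreover have "snd t \<subseteq>\<^sub>m e"
    unfolding map_le_def assms(2)
  proof
    fix v assume "v \<in> univ_vars (fst t)"
    then have "v \<notin> exist_vars (fst t)" using univ_exist_disjoint by fast
    then show "snd t v = e v" by (simp add: e_def)
  qed
  ultimately have "is_extension t e"
    using assms(2) by (simp add: is_extension_def case_prod_unfold)
  moreover have "\<forall>z \<in> exist_vars (fst t). \<exists>n. e z = Some (Null n) \<and> Null n \<notin> inst_vals I"
    using fresh by (simp add: e_def)
  moreover have "inj_on e (exist_vars (fst t))" by (simp add: e_def inj_on_def)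
  ultimately have "fresh_extension I t e" by (simp add: fresh_extension_def)
  then have "fires I t (I \<union> app_conj e (head (fst t)))"
    unfolding fires_iff by (intro exI conjI) (assumption, rule refl)
  then show ?thesis by (rule exI)
qed

lemma fires_finite: "fires I t J \<Longrightarrow> finite I \<Longrightarrow> finite J"
  by (auto simp: fires_def app_conj_def)

text \<open>The least bound on the numbers inside the constants and nulls that the trigger assigns.
  It is meaningful for triggers with finite range and serves as a priority for building a fair
  chase.\<close>

definition trigger_index :: "'r trigger \<Rightarrow> nat" where
  "trigger_index t = (LEAST n. ran (snd t) \<subseteq> Const ` {..n} \<union> Null ` {..n})"

text \<open>A bounded index leaves finitely many values, to be assigned to the finitely many
  universal variables of finitely many tgds.\<close>

lemma finite_trigger_index_le:
  assumes "finite \<Sigma>"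
  shows "finite {t. fst t \<in> \<Sigma> \<and> dom (snd t) = univ_vars (fst t) \<and> trigger_index t \<le> n}" (is "finite ?T")
proof -
  let ?V = "\<lambda>n. Const ` {..n} \<union> Null ` {..n}"
  have "ran h \<subseteq> ?V (trigger_index (\<xi>, h))" if "dom h = univ_vars \<xi>" for \<xi> :: "'a tgd" and h
  proof -
    have "finite (dom h)" using that by (simp add: univ_vars_def)
    then have fin: "finite (ran h)" by (rule finite_ran)
    \<comment> \<open>A finite range fits below some bound, so the \<open>LEAST\<close> in
      \<open>trigger_index\<close> is attained.\<close>
    have "\<exists>n. X \<subseteq> ?V n" if "finite X" for X
      using that
    proof induction
      case (insert x X)
      then obtain n where n: "X \<subseteq> ?V n" by blast
      obtain k where k: "x = Const k \<or> x = Null k" by (cases x) auto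
      have "?V n \<subseteq> ?V (max n k)" "x \<in> ?V (max n k)" using k by auto
      with n show ?case by blast
    qed simp
    from this[OF fin] show ?thesis
      unfolding trigger_index_def snd_conv by (rule LeastI_ex)
  qed
  moreover have "?V m \<subseteq> ?V n" if "m \<le> n" for m using that by auto
  ultimately have "ran h \<subseteq> ?V n"
    if "dom h = univ_vars \<xi>" "trigger_index (\<xi>, h) \<le> n" for \<xi> :: "'a tgd" and h
    using that by (meson order_trans)
  then have "?T \<subseteq> (\<Union>\<xi>\<in>\<Sigma>. {\<xi>} \<times> {h. dom h = univ_vars \<xi> \<and> ran h \<subseteq> ?V n})"
    by (intro subsetI) (simp add: split_paired_all)
  moreover have "finite (\<Union>\<xi>\<in>\<Sigma>. {\<xi>} \<times> {h. dom h = univ_vars \<xi> \<and> ran h \<subseteq> ?V n})"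
    using assms by (intro finite_UN_I finite_cartesian_product finite_set_of_finite_maps)
      (auto simp: univ_vars_def)
  ultimately show ?thesis by (rule finite_subset)
qed

text \<open>Firing an applicable trigger of least index is fair, because only finitely many triggers
  have an index at most that of a given one and none of them is fired twice.\<close>

lemma ex_sobl_chase_seq:
  assumes "finite \<Sigma>" "finite I"
  shows "\<exists>N Is ts. chase_seq Sobl \<Sigma> I N Is ts"
proof -
  \<comment> \<open>A state consists of the current instance and the triggers fired so far. Once
    nothing is applicable, \<open>pick\<close> and \<open>step\<close> return unspecified values,
    but a finite chase is cut off at the first such index.\<close>
  define pick where "pick s = arg_min trigger_index (applicable Sobl \<Sigma> (snd s) (fst s))"
    for s :: "'a inst \<times> 'a trigger set"
  define step where "step s = (SOME J. fires (fst s) (pick s) J, insert (pick s) (snd s))"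
    for s :: "'a inst \<times> 'a trigger set"
  define st where "st i = (step ^^ i) (I, {})" for i
  define Is where "Is i = fst (st i)" for i
  define ts where "ts i = pick (st i)" for i
  have st_Suc: "st (Suc i) = step (st i)" for i by (simp add: st_def)
  have Is_Suc: "Is (Suc i) = (SOME J. fires (Is i) (ts i) J)" for i
    by (simp add: Is_def ts_def st_Suc step_def)
  have fired: "snd (st i) = ts ` {..<i}" for i
  proof (induction i)
    case 0
    show ?case by (simp add: st_def)
  next
    case (Suc i)
    have "snd (st (Suc i)) = insert (ts i) (snd (st i))" by (simp add: st_Suc step_def ts_def)
    then show ?case by (simp add: Suc.IH lessThan_Suc)
  qed
  have app_eq: "applicable_at Sobl \<Sigma> Is ts i = applicable Sobl \<Sigma> (snd (st i)) (fst (st i))" for i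
    by (rule ext) (simp only: applicable_at_def fired Is_def)
  have ts: "ts i = arg_min trigger_index (applicable_at Sobl \<Sigma> Is ts i)" for i
    unfolding app_eq by (simp only: ts_def pick_def)
  define live where "live i \<longleftrightarrow> (\<exists>t. applicable_at Sobl \<Sigma> Is ts i t)" for i
  have app: "applicable_at Sobl \<Sigma> Is ts i (ts i)" if "live i" for i
  proof -
    obtain t where "applicable_at Sobl \<Sigma> Is ts i t" using \<open>live i\<close> unfolding live_def by (rule exE)
    then show ?thesis by (subst ts) (rule arg_min_natI)
  qed
  have least: "trigger_index (ts i) \<le> trigger_index t" if "applicable_at Sobl \<Sigma> Is ts i t" for i t
    using that by (subst ts) (rule arg_min_nat_le)
  have Is0: "Is 0 = I" by (simp add: Is_def st_def)
  have fire: "fires (Is i) (ts i) (Is (Suc i))" if "finite (Is i)" "live i" for i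
    unfolding Is_Suc
    by (rule someI_ex) (rule ex_fires[OF that(1) applicable_at_trigger(2)[OF app[OF that(2)]]])
  \<comment> \<open>Finiteness of the instances is what provides fresh nulls, and so justifies the
    \<open>SOME\<close> in \<open>step\<close>.\<close>
  have fin: "finite (Is i)" if "\<And>j. j < i \<Longrightarrow> live j" for i
    using that
  proof (induction i)
    case (Suc i)
    then have "finite (Is i)" "live i" by auto
    then show ?case using fire fires_finite by blast
  qed (simp add: Is0 assms(2))
  show ?thesis
  proof (cases "\<forall>i. live i")
    case False
    define n where "n = (LEAST i. \<not> live i)"
    have n: "\<not> live n" "\<And>i. i < n \<Longrightarrow> live i"
      using False LeastI_ex[of "\<lambda>i. \<not> live i"] not_less_Least[of _ "\<lambda>i. \<not> live i"]
      unfolding n_def by blast+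
    then have "chase_seq Sobl \<Sigma> I (enat n) Is ts"
      using app fire fin Is0 unfolding chase_seq_def by (auto simp: live_def)
    then show ?thesis by blast
  next
    case True
    have "\<exists>j\<ge>i. ts j = t \<or> \<not> applicable_at Sobl \<Sigma> Is ts j t"
      if "applicable_at Sobl \<Sigma> Is ts i t" for i t
    proof (rule ccontr)
      assume "\<not> ?thesis"
      then have t: "applicable_at Sobl \<Sigma> Is ts j t" if "j \<ge> i" for j using that by auto
      have "trigger_index (ts j) \<le> trigger_index t" if "j \<ge> i" for j
        by (rule least[OF t[OF that]])
      then have "ts ` {i..} \<subseteq> {s. fst s \<in> \<Sigma> \<and> dom (snd s) = univ_vars (fst s)
          \<and> trigger_index s \<le> trigger_index t}"
        using applicable_at_trigger(1,2)[OF app] True by (simp add: image_subset_iff)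
      then have "finite (ts ` {i..})"
        using finite_trigger_index_le[OF assms(1)] by (rule finite_subset)
      moreover have "inj ts"
      proof (rule linorder_injI)
        fix a b :: nat assume "a < b"
        moreover have "\<not> (\<exists>s \<in> ts ` {..<b}. trigger_equiv s (ts b))"
          using app[OF spec[OF True, of b]] unfolding applicable_at_def applicable.simps by (rule conjunct2)
        ultimately have "\<not> trigger_equiv (ts a) (ts b)" by blast
        then show "ts a \<noteq> ts b" by (metis trigger_equiv_def)
      qed
      ultimately have "finite {i..}" by (meson finite_imageD inj_on_subset top_greatest)
      then show False using infinite_Ici by blast
    qed
    then have "chase_seq Sobl \<Sigma> I \<infinity> Is ts"
      using app fire fin Is0 True by (simp add: chase_seq_def)
    then show ?thesis by blast
  qed
qed

text \<open>Extends termination from chase sequences to unfair runs. Some chase sequence from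
  \<open>I\<close> exists; if it is finite it bounds every run, and if it is infinite it contradicts
  membership in \<open>CT\<close>.\<close>

lemma CT_sobl_no_infinite_run:
  assumes "\<Sigma> \<in> CT Sobl S" "is_inst S I" "run Sobl \<Sigma> \<infinity> Is ts es" "Is 0 = I"
  shows False
proof -
  have "finite \<Sigma>" "finite I" using assms(1,2) by (simp_all add: CT_iff is_tgd_set_def is_inst_def)
  then obtain N Is' ts' where c: "chase_seq Sobl \<Sigma> I N Is' ts'"
    using ex_sobl_chase_seq by metis
  show False
  proof (cases N)
    case (enat n)
    from sobl_no_infinite_run[OF c[unfolded enat] assms(3,4)] show False .
  next
    case infinity
    then show False using c assms(1,2) by (simp add: CT_iff)
  qed
qed

section \<open>Enriched dependencies\<close>

lemma body_enrich [simp]: "body (enrich H \<xi>) = body \<xi>"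
  and head_enrich [simp]: "head (enrich H \<xi>) = head \<xi> @ [Atom (H \<xi>) (map Var (frontier \<xi>))]"
  by (simp_all add: enrich_def)

lemma univ_vars_enrich [simp]: "univ_vars (enrich H \<xi>) = univ_vars \<xi>"
  by (simp add: univ_vars_def)

text \<open>The added atom contains only frontier variables, which occur in the head already. Hence
  frontier and existential variables are unaffected by enrichment.\<close>

lemma head_vars_enrich [simp]:
  "set (conj_vars (head (enrich H \<xi>))) = set (conj_vars (head \<xi>))"
proof -
  have "set (conj_vars [Atom r (map Var vs)]) = set vs" for r :: 'a and vs
    by (auto simp: set_conj_vars)
  moreover have "set (conj_vars (as @ bs)) = set (conj_vars as) \<union> set (conj_vars bs)"
    for as bs :: "('a, tm) atom list" by (simp add: conj_vars_def)
  ultimately show ?thesis using head_vars[of \<xi>] by auto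
qed

lemma frontier_enrich [simp]: "frontier (enrich H \<xi>) = frontier \<xi>"
  unfolding frontier_def by (simp only: head_vars_enrich body_enrich)

lemma exist_vars_enrich [simp]: "exist_vars (enrich H \<xi>) = exist_vars \<xi>"
  unfolding exist_vars_def by (simp only: head_vars_enrich body_enrich)

lemma enrich_inject: "enrich H \<xi> = enrich H \<zeta> \<Longrightarrow> \<xi> = \<zeta>"
  by (cases \<xi>; cases \<zeta>) (simp add: enrich_def)

definition enrich_trigger :: "('r tgd \<Rightarrow> 'r) \<Rightarrow> 'r trigger \<Rightarrow> 'r trigger" where
  "enrich_trigger H t = (enrich H (fst t), snd t)"

lemma fst_enrich_trigger [simp]: "fst (enrich_trigger H t) = enrich H (fst t)"
  and snd_enrich_trigger [simp]: "snd (enrich_trigger H t) = snd t"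
  by (simp_all add: enrich_trigger_def)

lemma is_extension_enrich [simp]: "is_extension (enrich_trigger H t) e \<longleftrightarrow> is_extension t e"
  by (cases t) (simp add: is_extension_def enrich_trigger_def)

lemma trigger_equiv_enrich:
  "trigger_equiv s t \<Longrightarrow> trigger_equiv (enrich_trigger H s) (enrich_trigger H t)"
  by (simp add: trigger_equiv_iff)

text \<open>The ground \<open>H\<close>-atom of a trigger. It uses only the frontier values and is
  therefore determined by the equivalence class.\<close>

definition record_atom :: "('r tgd \<Rightarrow> 'r) \<Rightarrow> 'r trigger \<Rightarrow> ('r, val) atom" where
  "record_atom H t = Atom (H (fst t)) (map (\<lambda>v. the (snd t v)) (frontier (fst t)))"

text \<open>An extension agrees with its trigger on the frontier, so the added atom does not depend
  on how the existential variables are chosen.\<close>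

lemma app_conj_head_enrich:
  assumes "is_extension t e" "dom (snd t) = univ_vars (fst t)"
  shows "app_conj e (head (enrich H (fst t))) = insert (record_atom H t) (app_conj e (head (fst t)))"
proof -
  have "e v = snd t v" if "v \<in> set (frontier (fst t))" for v
    using that assms by (cases t) (auto simp: is_extension_def set_frontier map_le_def)
  then have "map (\<lambda>v. the (e v)) (frontier (fst t)) = map (\<lambda>v. the (snd t v)) (frontier (fst t))"
    by simp
  then show ?thesis by (simp add: app_conj_def record_atom_def comp_def del: map_eq_conv)
qed

lemma app_conj_over:
  assumes "\<forall>a\<in>set as. atom_over S a"
  shows "app_conj h as \<subseteq> {a. rel a \<in> dom S}"
  using assms by (force simp: app_conj_def atom_over_def)

text \<open>Records repeat values matched by the body, so adding them to an instance keeps fresh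
  nulls fresh.\<close>

lemma inst_vals_record_atom:
  assumes "dom (snd t) = univ_vars (fst t)" "app_conj (snd t) (body (fst t)) \<subseteq> I"
  shows "set (args (record_atom H t)) \<subseteq> inst_vals I"
  using assms(2) by (auto simp: record_atom_def set_frontier univ_vars_def intro: val_in_inst_vals)

text \<open>Injectivity of \<open>H\<close> recovers the tgd from the relation symbol, and the
  arguments recover the frontier values. The domain conditions turn equality under
  \<open>the\<close> into equality of the partial maps on the frontier.\<close>

lemma record_atom_eq_iff:
  assumes "inj_on H \<Sigma>" "fst s \<in> \<Sigma>" "fst t \<in> \<Sigma>"
    and "dom (snd s) = univ_vars (fst s)" "dom (snd t) = univ_vars (fst t)"
  shows "record_atom H s = record_atom H t \<longleftrightarrow> trigger_equiv s t"
proof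
  assume "record_atom H s = record_atom H t"
  then have eq: "fst s = fst t"
    "\<forall>v\<in>set (frontier (fst t)). the (snd s v) = the (snd t v)"
    using assms(1-3) by (auto simp: record_atom_def dest: inj_onD)
  have "snd s v = snd t v" if "v \<in> set (frontier (fst t))" for v
  proof -
    have "v \<in> dom (snd s)" "v \<in> dom (snd t)" using that assms(4,5) eq(1) by (auto simp: set_frontier)
    then show ?thesis using eq(2) that by auto
  qed
  with eq(1) show "trigger_equiv s t" by (simp add: trigger_equiv_iff)
next
  assume "trigger_equiv s t"
  then show "record_atom H s = record_atom H t"
    by (auto simp: trigger_equiv_iff record_atom_def)
qed


section \<open>Translating runs between a set of tgds and its enrichment\<close>

lemma semi_enrichment_triggerE:
  assumes "fst t \<in> semi_enrichment H \<Sigma>"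
  obtains s where "t = enrich_trigger H s" "fst s \<in> \<Sigma>"
proof -
  obtain \<xi> where "\<xi> \<in> \<Sigma>" "fst t = enrich H \<xi>" using assms by (auto simp: semi_enrichment_def)
  then show thesis using that[of "(\<xi>, snd t)"] by (simp add: enrich_trigger_def prod_eq_iff)
qed

text \<open>Bodies use only symbols of \<open>S\<close>, so matching them in \<open>I'\<close> sees
  just the part of \<open>I'\<close> over \<open>S\<close>.\<close>

lemma is_trigger_enrich:
  assumes "is_tgd_set S \<Sigma>" "{a \<in> I'. rel a \<in> dom S} = I"
  shows "is_trigger (semi_enrichment H \<Sigma>) I' (enrich_trigger H t) \<longleftrightarrow> is_trigger \<Sigma> I t"
proof -
  have "enrich H (fst t) \<in> semi_enrichment H \<Sigma> \<longleftrightarrow> fst t \<in> \<Sigma>"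
    by (auto simp: semi_enrichment_def dest: enrich_inject)
  moreover have "app_conj (snd t) (body (fst t)) \<subseteq> {a. rel a \<in> dom S}" if "fst t \<in> \<Sigma>"
    using assms(1) that by (intro app_conj_over) (auto simp: is_tgd_set_def tgd_over_def)
  ultimately show ?thesis
    using assms(2) by (cases t) (auto simp: is_trigger_def enrich_trigger_def)
qed

text \<open>An earlier equivalent trigger leaves its enriched head in the instance and makes the
  later one inactive. A standard run thus fires each class at most once, as a semi-oblivious run
  must.\<close>

lemma std_run_restrict:
  assumes \<Sigma>: "is_tgd_set S \<Sigma>" and H: "new_symbols S \<Sigma> H"
    and r: "run Std (semi_enrichment H \<Sigma>) \<infinity> Is' ts' es"
    and Is: "\<And>i. Is i = {a \<in> Is' i. rel a \<in> dom S}"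
  shows "\<exists>ts. run Sobl \<Sigma> \<infinity> Is ts es"
proof -
  have app': "applicable_at Std (semi_enrichment H \<Sigma>) Is' ts' i (ts' i)" for i
    using r by (simp add: run_def)
  have "\<exists>t. ts' i = enrich_trigger H t \<and> fst t \<in> \<Sigma>" for i
    using applicable_at_trigger(1)[OF app'] by (metis semi_enrichment_triggerE)
  then obtain ts where ts: "\<And>i. ts' i = enrich_trigger H (ts i)" "\<And>i. fst (ts i) \<in> \<Sigma>" by metis
  have dom: "dom (snd (ts i)) = univ_vars (fst (ts i))" for i
    using applicable_at_trigger(2)[OF app', of i] by (simp add: ts(1))
  \<comment> \<open>Freshness for \<open>Is' i\<close> passes to its restriction, so the same
    extensions serve both runs.\<close>
  have fe: "fresh_extension (Is i) (ts i) (es i)" for i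
  proof -
    have "inst_vals (Is i) \<subseteq> inst_vals (Is' i)" by (rule inst_vals_mono) (auto simp: Is)
    moreover have "fresh_extension (Is' i) (ts' i) (es i)" using r by (simp add: run_def)
    ultimately show ?thesis unfolding fresh_extension_def ts(1) by fastforce
  qed
  have "\<not> trigger_equiv (ts i) (ts j)" if "i < j" for i j
  proof
    assume "trigger_equiv (ts i) (ts j)"
    then have "trigger_equiv (ts' i) (ts' j)" by (simp add: ts(1) trigger_equiv_enrich)
    moreover have "is_extension (ts' i) (es i)" using fe by (simp add: ts(1) fresh_extension_def)
    moreover have "app_conj (es i) (head (fst (ts' i))) \<subseteq> Is' j" using run_head[OF r that] by simp
    ultimately have "\<not> active (Is' j) (ts' j)"
      by (rule not_active_if_equiv) (simp add: ts(1) dom)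
    then show False using app'[of j] by (simp add: applicable_at_def)
  qed
  moreover have "is_trigger \<Sigma> (Is i) (ts i)" for i
    using app'[of i] is_trigger_enrich[OF \<Sigma> Is[symmetric]] by (simp add: applicable_at_def ts(1))
  moreover have "Is (Suc i) = Is i \<union> app_conj (es i) (head (fst (ts i)))" for i
  proof -
    have "Is' (Suc i) = Is' i \<union> insert (record_atom H (ts i)) (app_conj (es i) (head (fst (ts i))))"
      using r app_conj_head_enrich[OF _ dom] fe by (simp add: run_def ts(1) fresh_extension_def)
    moreover have "rel (record_atom H (ts i)) \<notin> dom S"
      using H ts(2)[of i] by (auto simp: new_symbols_def record_atom_def)
    moreover have "app_conj (es i) (head (fst (ts i))) \<subseteq> {a. rel a \<in> dom S}"
      using \<Sigma> ts(2) by (intro app_conj_over) (auto simp: is_tgd_set_def tgd_over_def)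
    ultimately show ?thesis by (auto simp: Is)
  qed
  ultimately have "run Sobl \<Sigma> \<infinity> Is ts es"
    using fe by (auto simp: run_def applicable_at_def)
  then show ?thesis by blast
qed

text \<open>The initial instance is over \<open>S\<close> and contains no records. Every record in
  the \<open>i\<close>-th enlarged instance therefore stems from a trigger fired before step
  \<open>i\<close>, so that activity and membership in an unfired class coincide.\<close>

lemma sobl_chase_enrich:
  assumes \<Sigma>: "is_tgd_set S \<Sigma>" and H: "new_symbols S \<Sigma> H"
    and I: "is_inst S I" and c: "chase_seq Sobl \<Sigma> I \<infinity> Is ts"
  shows "chase_seq Std (semi_enrichment H \<Sigma>) I \<infinity>
    (\<lambda>i. Is i \<union> record_atom H ` ts ` {..<i}) (\<lambda>i. enrich_trigger H (ts i))"
    (is "chase_seq Std ?\<Sigma> I \<infinity> ?Is ?ts")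
proof -
  obtain es where r: "run Sobl \<Sigma> \<infinity> Is ts es" using chase_seq_run[OF c] .
  have app: "applicable_at Sobl \<Sigma> Is ts i (ts i)" for i using r by (simp add: run_def)
  note tr = applicable_at_trigger[OF app]
  have fe: "fresh_extension (Is i) (ts i) (es i)" for i using r by (simp add: run_def)
  have ext: "is_extension (ts i) (es i)" for i using fe by (simp add: fresh_extension_def)
  have Suc: "Is (Suc i) = Is i \<union> app_conj (es i) (head (fst (ts i)))" for i
    using r by (simp add: run_def)
  have old: "Is i \<subseteq> {a. rel a \<in> dom S}" for i
  proof (induction i)
    case 0
    then show ?case using I c by (auto simp: chase_seq_def is_inst_def atom_over_def)
  next
    case (Suc i)
    moreover have "app_conj (es i) (head (fst (ts i))) \<subseteq> {a. rel a \<in> dom S}"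
      using \<Sigma> tr(1)[of i] by (intro app_conj_over) (auto simp: is_tgd_set_def tgd_over_def)
    ultimately show ?case by (simp add: \<open>Is (Suc i) = _\<close>)
  qed
  have new: "rel (record_atom H t) \<notin> dom S" if "fst t \<in> \<Sigma>" for t
    using H that by (auto simp: new_symbols_def record_atom_def)
  have restr: "{a \<in> ?Is i. rel a \<in> dom S} = Is i" for i
  proof -
    have "rel a \<notin> dom S" if a: "a \<in> record_atom H ` ts ` {..<i}" for a
    proof -
      from a obtain j where "a = record_atom H (ts j)" by (elim imageE) simp
      then show ?thesis using new[OF tr(1)] by simp
    qed
    then show ?thesis using old[of i] by blast
  qed
  have vals: "inst_vals (?Is i) = inst_vals (Is i)" for i
  proof -
    have "set (args (record_atom H (ts j))) \<subseteq> inst_vals (Is i)" if "j < i" for j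
    proof -
      have "Is j \<subseteq> Is i" using run_mono[OF r] that by simp
      then show ?thesis
        using inst_vals_record_atom[OF tr(2), of j "Is i"] tr(3)[of j] by blast
    qed
    then have "inst_vals (record_atom H ` ts ` {..<i}) \<subseteq> inst_vals (Is i)"
      by (auto simp: inst_vals_def)
    then show ?thesis by auto
  qed
  have headH: "app_conj (es i) (head (enrich H (fst (ts i))))
      = insert (record_atom H (ts i)) (app_conj (es i) (head (fst (ts i))))" for i
    using app_conj_head_enrich[OF ext tr(2)] .
  \<comment> \<open>A fired equivalent trigger leaves its whole enriched head behind. Conversely,
    inactivity puts the record of \<open>t\<close> into the instance, and only a fired trigger of
    the same class can have supplied it.\<close>
  have active: "active (?Is i) (enrich_trigger H t) \<longleftrightarrow> \<not> (\<exists>s \<in> ts ` {..<i}. trigger_equiv s t)"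
    if t: "is_trigger \<Sigma> (Is i) t" for i t
  proof -
    have t': "fst t \<in> \<Sigma>" "dom (snd t) = univ_vars (fst t)"
      using t by (auto simp: is_trigger_def split: prod.splits)
    have "\<not> active (?Is i) (enrich_trigger H t)" if j: "j < i" "trigger_equiv (ts j) t" for j
    proof (rule not_active_if_equiv)
      show "trigger_equiv (enrich_trigger H (ts j)) (enrich_trigger H t)"
        using j(2) by (rule trigger_equiv_enrich)
      show "app_conj (es j) (head (fst (enrich_trigger H (ts j)))) \<subseteq> ?Is i"
        using run_head[OF r j(1)] j(1) headH[of j] by auto
    qed (simp_all add: ext t')
    moreover have "\<exists>s \<in> ts ` {..<i}. trigger_equiv s t" if "\<not> active (?Is i) (enrich_trigger H t)"
    proof -
      obtain e where "is_extension t e" "app_conj e (head (enrich H (fst t))) \<subseteq> ?Is i"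
        using \<open>\<not> active _ _\<close> by (auto simp: active_def simp del: head_enrich)
      then have "record_atom H t \<in> ?Is i"
        using app_conj_head_enrich[OF _ t'(2), of e H] by auto
      moreover have "record_atom H t \<notin> Is i" using old[of i] new[OF t'(1)] by blast
      ultimately have "record_atom H t \<in> record_atom H ` ts ` {..<i}" by blast
      then obtain j where "j < i" "record_atom H t = record_atom H (ts j)"
        by (elim imageE) simp
      then have "trigger_equiv (ts j) t"
        using record_atom_eq_iff[of H \<Sigma> "ts j" t] H t' tr(1,2)[of j] by (simp add: new_symbols_def)
      with \<open>j < i\<close> show ?thesis by blast
    qed
    ultimately show ?thesis by blast
  qed
  have applicable: "applicable_at Std ?\<Sigma> ?Is ?ts i (enrich_trigger H t) \<longleftrightarrow>
      applicable_at Sobl \<Sigma> Is ts i t" for i t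
    using active[of i t] is_trigger_enrich[OF \<Sigma> restr, of H i t] by (auto simp: applicable_at_def)
  have "fires (?Is i) (?ts i) (?Is (Suc i))" for i
  proof -
    have "fresh_extension (?Is i) (?ts i) (es i)"
      using fe[of i]
      unfolding fresh_extension_def vals is_extension_enrich fst_enrich_trigger exist_vars_enrich .
    moreover have "?Is (Suc i) = ?Is i \<union> app_conj (es i) (head (fst (?ts i)))"
      using headH[of i] Suc[of i] by (auto simp: lessThan_Suc)
    ultimately show ?thesis unfolding fires_iff by blast
  qed
  moreover have "\<exists>j\<ge>i. ?ts j = t \<or> \<not> applicable_at Std ?\<Sigma> ?Is ?ts j t"
    if t: "applicable_at Std ?\<Sigma> ?Is ?ts i t" for i t
  proof -
    \<comment> \<open>Every trigger for the enrichment comes from one for \<open>\<Sigma>\<close>,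
      so fairness transfers through the equivalence of applicability.\<close>
    obtain s where s: "t = enrich_trigger H s"
      using applicable_at_trigger(1)[OF t] by (rule semi_enrichment_triggerE)
    then have "applicable_at Sobl \<Sigma> Is ts i s" using t applicable by simp
    then have "\<exists>j\<ge>i. ts j = s \<or> \<not> applicable_at Sobl \<Sigma> Is ts j s"
      using c unfolding chase_seq_def by blast
    then show ?thesis unfolding s applicable by auto
  qed
  ultimately show ?thesis
    using c app applicable unfolding chase_seq_def by simp
qed

theorem theorem4:
  fixes S :: "'r schema" and \<Sigma> :: "'r tgd set" and H :: "'r tgd \<Rightarrow> 'r"
  assumes "is_schema S"
    and "is_tgd_set S \<Sigma>"
    and "new_symbols S \<Sigma> H"
  shows "\<Sigma> \<in> CT Sobl S \<longleftrightarrow> semi_enrichment H \<Sigma> \<in> CT Std (enriched_schema H \<Sigma> S)"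
proof
  assume ct: "\<Sigma> \<in> CT Sobl S"
  have False if I: "is_inst (enriched_schema H \<Sigma> S) I"
    and c: "chase_seq Std (semi_enrichment H \<Sigma>) I \<infinity> Is ts" for I Is ts
  proof -
    obtain es where r: "run Std (semi_enrichment H \<Sigma>) \<infinity> Is ts es" using chase_seq_run[OF c] .
    \<comment> \<open>The initial instance may itself contain \<open>H\<close>-atoms; they are
      dropped too, so the semi-oblivious run starts from \<open>Js 0\<close> and may be
      unfair.\<close>
    define Js where "Js i = {a \<in> Is i. rel a \<in> dom S}" for i
    obtain us where "run Sobl \<Sigma> \<infinity> Js us es"
      using std_run_restrict[OF assms(2,3) r Js_def] by blast
    moreover have "is_inst S (Js 0)"
      using I c assms(3)
      by (auto simp: Js_def chase_seq_def is_inst_def atom_over_def enriched_schema_def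
          new_symbols_def split: if_splits)
    ultimately show False using CT_sobl_no_infinite_run[OF ct] by blast
  qed
  then show "semi_enrichment H \<Sigma> \<in> CT Std (enriched_schema H \<Sigma> S)"
    using semi_enrichment_is_tgd_set[OF assms(2,3)] by (auto simp: CT_iff)
next
  assume ct: "semi_enrichment H \<Sigma> \<in> CT Std (enriched_schema H \<Sigma> S)"
  have "is_inst (enriched_schema H \<Sigma> S) I" if "is_inst S I" for I
    using that assms(3)
    by (auto simp: is_inst_def atom_over_def enriched_schema_def new_symbols_def)
  then show "\<Sigma> \<in> CT Sobl S"
    using ct sobl_chase_enrich[OF assms(2,3)] assms(2) unfolding CT_iff by blast
qed

end
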